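(* Let $A\subset B$ be integral domains where $A$ is a Noetherian local ring. Let $I$ be an ideal in $B$ which is ultimately power stable in $A$, and let $m\geq 1$ be an integer such that $I^l\cap A=(I\cap A)^l$ for all $l>m$, but $I^m\cap A\neq (I\cap A)^m$. Then for integers $t$ with $1\leq t\leq m$ we have: (i) for all $t$ with $1\leq t\leq m+1-t$, $(I^{m+1-t}\cap A)^r=((I\cap A)^{m+1-t})^r$ for some $r\geq 1$; (ii) for all $t$ with $t>m-t+1$, $(I\cap A)^{m-t+1}\,(I^{m-t+1}\cap A)^r=((I\cap A)^{m-t+1})^{r+1}$ for some $r\geq 1$.
   Context: All rings are commutative with identity. For rings $A\subset B$, an ideal $I$ of $B$ is called ultimately power stable in $A$ if $I^n\cap A=(I\cap A)^n$ for all sufficiently large $n$. *)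

theory Defs
  imports "HOL-Algebra.Algebra"
begin

text \<open>
  A ring extension \<open>A \<subseteq> B\<close> is given by a ring \<open>B\<close> and a carrier set \<open>A \<subseteq> carrier B\<close> that is a
  subring with the same identity; as a ring in its own right \<open>A\<close> is \<open>B\<lparr>carrier := A\<rparr>\<close>.
  Powers of ideals are the powers in the monoid \<open>ideals_set R\<close>. The ambient ring matters:
  for ideals of \<open>A\<close>, products are formed in \<open>A\<close> and the zeroth power is \<open>A\<close> rather than
  \<open>carrier B\<close>.
\<close>

locale local_ring = cring +
  assumes unique_maximal: "\<exists>!M. maximalideal M R"

abbreviation ideal_pow :: "('a, 'b) ring_scheme \<Rightarrow> 'a set \<Rightarrow> nat \<Rightarrow> 'a set"
  where "ideal_pow R I n \<equiv> I [^]\<^bsub>ideals_set R\<^esub> n"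

definition ultimately_power_stable :: "('a, 'b) ring_scheme \<Rightarrow> 'a set \<Rightarrow> 'a set \<Rightarrow> bool"
  where "ultimately_power_stable B A I \<longleftrightarrow>
    (\<forall>\<^sub>F n in sequentially. ideal_pow B I n \<inter> A = ideal_pow (B\<lparr>carrier := A\<rparr>) (I \<inter> A) n)"

end

theory Submission
  imports Defs
begin

text \<open>
  Put \<open>J = I \<inter> A\<close>, \<open>k = m + 1 - t \<ge> 1\<close> and \<open>K = I\<^sup>k \<inter> A\<close>. Then \<open>J\<^sup>k \<subseteq> K\<close>, while
  \<open>K\<^sup>s \<subseteq> I\<^bsup>k s\<^esup> \<inter> A = J\<^bsup>k s\<^esup>\<close> as soon as \<open>k s > m\<close>, for instance when \<open>s = m + 1\<close>. Hence
  \<open>K\<^sup>s = (J\<^sup>k)\<^sup>s\<close> for such \<open>s\<close>, which is (i), and (ii) follows by squeezing \<open>J\<^sup>k K\<^sup>r\<close> between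
  \<open>(J\<^sup>k)\<^bsup>r+1\<^esup>\<close> and \<open>K\<^bsup>r+1\<^esup>\<close> with \<open>r = m\<close>.
\<close>

lemma ideal_pow_0: "ideal_pow R I 0 = carrier R"
  by (simp add: ideals_set_def)

lemma ideal_pow_Suc: "ideal_pow R I (Suc n) = ideal_prod R (ideal_pow R I n) I"
  by (simp add: nat_pow_def ideals_set_def)

lemma (in cring) ideal_pow_is_ideal:
  assumes "ideal I R"
  shows "ideal (ideal_pow R I n) R"
proof -
  interpret S: comm_monoid "ideals_set R"
    by (rule ideals_set_is_comm_monoid)
  show ?thesis
    using S.nat_pow_closed[of I n] assms by (simp add: ideals_set_def)
qed

lemma (in cring) ideal_pow_pow:
  assumes "ideal I R"
  shows "ideal_pow R (ideal_pow R I k) n = ideal_pow R I (k * n)"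
proof -
  interpret S: comm_monoid "ideals_set R"
    by (rule ideals_set_is_comm_monoid)
  show ?thesis
    using S.nat_pow_pow[of I k n] assms by (simp add: ideals_set_def)
qed

text \<open>\<open>ideal_prod\<close> is generated by products and sums and never consults the
  carrier, so a product formed in the subring lies in the one formed in \<open>R\<close>. Choosing
  \<open>A\<close> to be the carrier of \<open>R\<close> gives ordinary monotonicity within one
  ring.\<close>

lemma ideal_prod_mono:
  assumes "P \<subseteq> P'" "Q \<subseteq> Q'"
  shows "ideal_prod (R\<lparr>carrier := A\<rparr>) P Q \<subseteq> ideal_prod R P' Q'"
proof
  fix s assume "s \<in> ideal_prod (R\<lparr>carrier := A\<rparr>) P Q"
  then show "s \<in> ideal_prod R P' Q'"
  proof induct
    case (prod i j)
    then show ?case using assms ideal_prod.prod[of i P' j Q' R] by auto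
  next
    case (sum s1 s2)
    then show ?case using ideal_prod.sum[of s1 R P' Q' s2] by simp
  qed
qed

lemma ideal_pow_mono:
  assumes "A \<subseteq> carrier R" "P \<subseteq> Q"
  shows "ideal_pow (R\<lparr>carrier := A\<rparr>) P n \<subseteq> ideal_pow R Q n"
proof (induct n)
  \<comment> \<open>The zeroth powers are the two carriers, so the base case is exactly
    \<open>A \<subseteq> carrier R\<close>.\<close>
  case 0
  then show ?case using assms by (simp only: ideal_pow_0) simp
next
  case (Suc n)
  then show ?case using assms unfolding ideal_pow_Suc by (intro ideal_prod_mono)
qed

lemma (in cring) ideal_contraction:
  assumes "subcring A R" "ideal I R"
  shows "ideal (I \<inter> A) (R\<lparr>carrier := A\<rparr>)"
proof -
  interpret I: ideal I R by fact
  have sub: "subring A R" by (rule subcring.axioms(1)[OF assms(1)])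
  note A = subringE[OF sub]
  interpret A: ring "R\<lparr>carrier := A\<rparr>"
    by (rule subring_is_ring[OF sub])
  have "subgroup (I \<inter> A) (add_monoid (R\<lparr>carrier := A\<rparr>))"
  proof (rule A.add.subgroupI)
    show "I \<inter> A \<noteq> {}" using I.zero_closed A(2) by blast
  next
    fix a assume a: "a \<in> I \<inter> A"
    \<comment> \<open>Negation is defined relative to the carrier, so the negative in
      \<open>A\<close> has to be identified with the one in \<open>R\<close> by uniqueness of
      additive inverses.\<close>
    then have "\<ominus>\<^bsub>R\<lparr>carrier := A\<rparr>\<^esub> a = \<ominus> a"
      using A by (intro A.minus_equality) (auto simp: l_neg subset_iff)
    then show "\<ominus>\<^bsub>R\<lparr>carrier := A\<rparr>\<^esub> a \<in> I \<inter> A"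
      using a A(5) I.a_inv_closed by simp
  next
    fix a b assume "a \<in> I \<inter> A" "b \<in> I \<inter> A"
    then show "a \<oplus>\<^bsub>R\<lparr>carrier := A\<rparr>\<^esub> b \<in> I \<inter> A"
      using A(7) I.a_closed by simp
  qed auto
  then show ?thesis
    using A(1,6) by (intro idealI A.ring_axioms) (auto intro: I.I_l_closed I.I_r_closed)
qed

text \<open>The left side is an ideal of \<open>A\<close>, hence inside \<open>A\<close>; by
  monotonicity it also lies in the \<open>n\<close>-th power of \<open>ideal_pow R I k\<close> taken
  in \<open>R\<close>, where exponents multiply.\<close>

lemma (in cring) ideal_pow_contraction_subset:
  assumes "subcring A R" "ideal I R"
  shows "ideal_pow (R\<lparr>carrier := A\<rparr>) (ideal_pow R I k \<inter> A) n \<subseteq> ideal_pow R I (k * n) \<inter> A"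
proof -
  have A: "A \<subseteq> carrier R" by (rule subcringE(1)[OF assms(1)])
  interpret A: cring "R\<lparr>carrier := A\<rparr>"
    using assms(1) subcring_iff[OF A] by simp
  have "ideal (ideal_pow R I k \<inter> A) (R\<lparr>carrier := A\<rparr>)"
    by (intro ideal_contraction ideal_pow_is_ideal assms)
  then have "ideal_pow (R\<lparr>carrier := A\<rparr>) (ideal_pow R I k \<inter> A) n \<subseteq> A"
    using additive_subgroup.a_subset[OF ideal.axioms(1)[OF A.ideal_pow_is_ideal]] by fastforce
  moreover have "ideal_pow (R\<lparr>carrier := A\<rparr>) (ideal_pow R I k \<inter> A) n
      \<subseteq> ideal_pow R (ideal_pow R I k) n"
    by (intro ideal_pow_mono A) simp
  ultimately show ?thesis
    by (simp add: ideal_pow_pow assms(2))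
qed

theorem theorem3p22:
  fixes B :: "('a, 'b) ring_scheme" and A I :: "'a set" and m :: nat
  assumes "domain B" and "subdomain A B"
    and "noetherian_ring (B\<lparr>carrier := A\<rparr>)" and "local_ring (B\<lparr>carrier := A\<rparr>)"
    and "ideal I B" and "ultimately_power_stable B A I"
    and "m \<ge> 1"
    and "\<And>l. l > m \<Longrightarrow> ideal_pow B I l \<inter> A = ideal_pow (B\<lparr>carrier := A\<rparr>) (I \<inter> A) l"
    and "ideal_pow B I m \<inter> A \<noteq> ideal_pow (B\<lparr>carrier := A\<rparr>) (I \<inter> A) m"
  shows "\<forall>t. 1 \<le> t \<and> t \<le> m \<longrightarrow>
      (t \<le> m + 1 - t \<longrightarrow>
        (\<exists>r\<ge>1. ideal_pow (B\<lparr>carrier := A\<rparr>) (ideal_pow B I (m + 1 - t) \<inter> A) r =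
           ideal_pow (B\<lparr>carrier := A\<rparr>)
             (ideal_pow (B\<lparr>carrier := A\<rparr>) (I \<inter> A) (m + 1 - t)) r)) \<and>
      (t > m - t + 1 \<longrightarrow>
        (\<exists>r\<ge>1. ideal_prod (B\<lparr>carrier := A\<rparr>)
             (ideal_pow (B\<lparr>carrier := A\<rparr>) (I \<inter> A) (m - t + 1))
             (ideal_pow (B\<lparr>carrier := A\<rparr>) (ideal_pow B I (m - t + 1) \<inter> A) r) =
           ideal_pow (B\<lparr>carrier := A\<rparr>)
             (ideal_pow (B\<lparr>carrier := A\<rparr>) (I \<inter> A) (m - t + 1)) (r + 1)))"
proof -
  interpret B: domain B by fact
  let ?R = "B\<lparr>carrier := A\<rparr>"
  have sub: "subcring A B"
    by (rule subdomain.axioms(1)[OF assms(2)])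
  have A: "A \<subseteq> carrier B" by (rule subcringE(1)[OF sub])
  interpret A: cring ?R
    using sub B.subcring_iff[OF A] by simp
  define J where "J = I \<inter> A"
  have J: "ideal J ?R"
    unfolding J_def by (rule B.ideal_contraction[OF sub \<open>ideal I B\<close>])
  have prod_mono: "ideal_prod ?R P Q \<subseteq> ideal_prod ?R P' Q'"
    if "P \<subseteq> P'" "Q \<subseteq> Q'" for P P' Q Q'
    using ideal_prod_mono[OF that, where R = ?R and A = A] by simp
  have pow_mono: "ideal_pow ?R P n \<subseteq> ideal_pow ?R Q n" if "P \<subseteq> Q" for P Q n
    using ideal_pow_mono[OF _ that, where R = ?R and A = A] by simp
  define K where "K k = ideal_pow B I k \<inter> A" for k
  have JK: "ideal_pow ?R J k \<subseteq> K k" for k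
  proof -
    have "ideal_pow ?R J k \<subseteq> ideal_pow B I k"
      by (rule ideal_pow_mono[OF A]) (simp add: J_def)
    moreover have "ideal_pow ?R J k \<subseteq> A"
      using additive_subgroup.a_subset[OF ideal.axioms(1)[OF A.ideal_pow_is_ideal[OF J]]]
      by fastforce
    ultimately show ?thesis by (simp add: K_def)
  qed
  have K_pow: "ideal_pow ?R (K k) n = ideal_pow ?R (ideal_pow ?R J k) n" if "k * n > m" for k n
  proof
    have "ideal_pow ?R (K k) n \<subseteq> ideal_pow B I (k * n) \<inter> A"
      unfolding K_def by (rule B.ideal_pow_contraction_subset[OF sub \<open>ideal I B\<close>])
    \<comment> \<open>Stability is applied at the exponent \<open>k * n\<close>, so \<open>k\<close>
      itself may be at most \<open>m\<close>.\<close>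
    also have "\<dots> = ideal_pow ?R J (k * n)"
      unfolding J_def using assms(8)[OF that] .
    finally show "ideal_pow ?R (K k) n \<subseteq> ideal_pow ?R (ideal_pow ?R J k) n"
      by (simp only: A.ideal_pow_pow[OF J])
  qed (rule pow_mono[OF JK])
  have km: "k * (m + 1) > m" if "k \<ge> 1" for k
    using mult_le_mono1[OF that, of "m + 1"] by simp
  have i: "\<exists>r\<ge>1. ideal_pow ?R (K k) r = ideal_pow ?R (ideal_pow ?R J k) r" if "k \<ge> 1" for k
    using K_pow[OF km[OF that]] by (intro exI[of _ "m + 1"]) simp
  have ii: "\<exists>r\<ge>1. ideal_prod ?R (ideal_pow ?R J k) (ideal_pow ?R (K k) r) =
      ideal_pow ?R (ideal_pow ?R J k) (r + 1)" if "k \<ge> 1" for k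
  \<comment> \<open>The witness is \<open>m\<close> because the right side has exponent
    \<open>r + 1\<close>, and \<open>km\<close> covers \<open>m + 1\<close>.\<close>
  proof (intro exI[of _ m] conjI equalityI)
    have K: "ideal (K k) ?R"
      unfolding K_def by (intro B.ideal_contraction sub B.ideal_pow_is_ideal \<open>ideal I B\<close>)
    \<comment> \<open>\<open>ideal_pow_Suc\<close> puts the extra factor on the right, whereas (ii)
      has it on the left.\<close>
    have comm: "ideal_prod ?R P (ideal_pow ?R Q m) = ideal_prod ?R (ideal_pow ?R Q m) P"
      if "ideal P ?R" "ideal Q ?R" for P Q
      by (intro A.ideal_prod_commute A.ideal_pow_is_ideal that)
    have Jk: "ideal (ideal_pow ?R J k) ?R"
      by (rule A.ideal_pow_is_ideal[OF J])
    have "ideal_prod ?R (ideal_pow ?R J k) (ideal_pow ?R (K k) m)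
        \<subseteq> ideal_prod ?R (ideal_pow ?R (K k) m) (K k)"
      unfolding comm[OF Jk K] by (intro prod_mono JK order_refl)
    also have "\<dots> = ideal_pow ?R (K k) (m + 1)"
      unfolding Suc_eq_plus1[symmetric] ideal_pow_Suc ..
    also have "\<dots> = ideal_pow ?R (ideal_pow ?R J k) (m + 1)"
      by (rule K_pow[OF km[OF that]])
    finally show "ideal_prod ?R (ideal_pow ?R J k) (ideal_pow ?R (K k) m)
      \<subseteq> ideal_pow ?R (ideal_pow ?R J k) (m + 1)" .
    have "ideal_pow ?R (ideal_pow ?R J k) (m + 1)
        = ideal_prod ?R (ideal_pow ?R J k) (ideal_pow ?R (ideal_pow ?R J k) m)"
      unfolding Suc_eq_plus1[symmetric] ideal_pow_Suc comm[OF Jk Jk] ..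
    also have "\<dots> \<subseteq> ideal_prod ?R (ideal_pow ?R J k) (ideal_pow ?R (K k) m)"
      by (intro prod_mono pow_mono JK order_refl)
    finally show "ideal_pow ?R (ideal_pow ?R J k) (m + 1)
      \<subseteq> ideal_prod ?R (ideal_pow ?R J k) (ideal_pow ?R (K k) m)" .
  qed (rule \<open>m \<ge> 1\<close>)
  show ?thesis
    \<comment> \<open>For \<open>t \<le> m\<close> the truncated differences
      \<open>m + 1 - t\<close> and \<open>m - t + 1\<close> agree and are at least 1, so
      \<open>i\<close> and \<open>ii\<close> apply with this value as \<open>k\<close>.\<close>
    unfolding J_def[symmetric] K_def[symmetric]
    by (intro allI impI conjI i ii) auto
qed

end
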